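(* Let $c>0$, let $K\geq 1$ be an integer, let $S=\{s_j : j=1,2,\ldots,K\}\subset\mathbb{R}^3$ be a set of mutually distinct source points, and let $\tau_j>0$ ($j=1,\ldots,K$) be the intensities of the point sources. Let $\lambda(t)=\delta(t)$ (the Dirac delta distribution) be the signal function, and let $u(x,t)$ be the (causal) solution to the wave equation $$c^{-2}\partial_{tt}u(x,t)-\triangle u(x,t)=\sum_{j=1}^{K}\lambda(t)\tau_j\delta(x-s_j),\qquad x\in\mathbb{R}^3,\ t\in\mathbb{R}.$$ Assume that $\Omega\subset\mathbb{R}^3$ is an open ball of radius $R$ with $S\subset\Omega$, with boundary sphere $\partial\Omega$, and that the sampling region $D\subset\Omega$ satisfies $S\subset D$ and $D\cap\partial\Omega=\varnothing$. For $z\in D$ define the indicator function $$I(z)=\int_{\mathbb{R}}\int_{\partial\Omega}u(x,t)\,\big(G(x,t;z)\ast\lambda(t)\big)\,{\rm d}s(x)\,{\rm d}t .$$ Then $$I(z)=+\infty\ \text{ for } z\in S,\qquad I(z)<+\infty\ \text{ for } z\in D\setminus S.$$ Moreover, $$\lim_{d(z,S)\to 0}I(z)=+\infty,\qquad\text{where } d(z,S)=\min_{j=1,\ldots,K}|z-s_j|.$$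
   Context: The Green's function of the d'Alembert operator $c^{-2}\partial_{tt}-\triangle$ in $\mathbb{R}^3$ is $G(x,t;s)=\dfrac{\delta(t-c^{-1}|x-s|)}{4\pi|x-s|}$, and $G(x,t;s)\ast\lambda(t)=\dfrac{\lambda(t-c^{-1}|x-s|)}{4\pi|x-s|}$ denotes convolution in time. The signal is causal (the source vanishes for $t<0$), and the solution of the wave equation is $u(x,t)=\sum_{j=1}^{K}\tau_j\,G(x,t;s_j)\ast\lambda(t)$. Here ${\rm d}s(x)$ is surface measure on $\partial\Omega$. Conventions for the delta distributions, since $\lambda=\delta$: the time integral is performed by the rule $\int_{\mathbb{R}}\delta(t-\alpha)\delta(t-\beta)\,{\rm d}t=\delta(\alpha-\beta)$, so that $$I(z)=\sum_{j=1}^{K}\tau_j\int_{\partial\Omega}\frac{\delta\left(c^{-1}|x-s_j|-c^{-1}|x-z|\right)}{16\pi^2|x-s_j||x-z|}\,{\rm d}s(x).$$ For a continuous function $f$ and a smooth function $h$ on the sphere $\partial\Omega$ whose tangential gradient $\nabla_{\partial\Omega}h$ does not vanish on $\{h=0\}$, $\int_{\partial\Omega}f\,\delta(h)\,{\rm d}s=\int_{\{h=0\}}\frac{f}{|\nabla_{\partial\Omega}h|}\,{\rm d}\ell$, where ${\rm d}\ell$ is arc length on the curve $\{h=0\}$. When $z=s_j$, the $j$-th term involves the square of a delta distribution, $\int_{\mathbb{R}}\int_{\partial\Omega}\tau_j\frac{\delta^2(t-c^{-1}|x-s_j|)}{16\pi^2|x-s_j|^2}\,{\rm d}s(x)\,{\rm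 d}t$, and is assigned the value $+\infty$. *)

theory Defs
  imports "HOL-Analysis.Analysis"
begin

section \<open>One-dimensional Hausdorff measure (arc length)\<close>

text \<open>With diameters as gauge and no further normalising factor, this measure agrees with arc
  length on rectifiable simple curves. The boundedness condition is needed because
  \<^const>\<open>diameter\<close> has an unspecified value on unbounded sets.\<close>

definition hausdorff1_pre :: "real \<Rightarrow> 'a::metric_space set \<Rightarrow> ennreal" where
  "hausdorff1_pre \<delta> A =
     (INF C \<in> {C :: nat \<Rightarrow> 'a set. A \<subseteq> (\<Union>i. C i) \<and> (\<forall>i. bounded (C i) \<and> diameter (C i) \<le> \<delta>)}.
        \<Sum>i. ennreal (diameter (C i)))"

definition hausdorff1_outer :: "'a::metric_space set \<Rightarrow> ennreal" where
  "hausdorff1_outer A = (SUP \<delta> \<in> {0<..}. hausdorff1_pre \<delta> A)"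

definition hausdorff1 :: "'a::metric_space measure" where
  "hausdorff1 = measure_of UNIV (sets borel) hausdorff1_outer"


section \<open>Delta distributions on a sphere\<close>

definition gradient :: "('a::real_inner \<Rightarrow> real) \<Rightarrow> 'a \<Rightarrow> 'a" where
  "gradient h x = (THE g. GDERIV h x :> g)"

text \<open>Tangential gradient at \<open>x\<close> on the sphere about \<open>a\<close> through \<open>x\<close>: the Euclidean gradient
  minus its component along the unit normal.\<close>

definition tangential_gradient :: "'a::real_inner \<Rightarrow> ('a \<Rightarrow> real) \<Rightarrow> 'a \<Rightarrow> 'a" where
  "tangential_gradient a h x =
     (let \<nu> = sgn (x - a) in gradient h x - (gradient h x \<bullet> \<nu>) *\<^sub>R \<nu>)"

definition C1_near :: "'a::real_inner set \<Rightarrow> ('a \<Rightarrow> real) \<Rightarrow> bool" where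
  "C1_near X h \<longleftrightarrow>
     (\<exists>U g. open U \<and> X \<subseteq> U \<and> continuous_on U g \<and> (\<forall>x\<in>U. GDERIV h x :> g x))"

text \<open>The integral of \<open>f \<delta>(h)\<close> over \<open>sphere a R\<close>, for nonnegative \<open>f\<close>. It has a meaning only for
  \<open>f\<close> continuous and \<open>h\<close> regular with nonvanishing tangential gradient on its zero set; outside
  this situation the value is unspecified. The Lebesgue integral with values in \<open>[0,\<infinity>]\<close> is used,
  so that finiteness is a genuine assertion.\<close>

definition surface_delta_integral ::
    "real^3 \<Rightarrow> real \<Rightarrow> (real^3 \<Rightarrow> real) \<Rightarrow> (real^3 \<Rightarrow> real) \<Rightarrow> ennreal" where
  "surface_delta_integral a R f h =
     (if continuous_on (sphere a R) f \<and> C1_near (sphere a R) h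
         \<and> (\<forall>x\<in>sphere a R. h x = 0 \<longrightarrow> tangential_gradient a h x \<noteq> 0)
      then \<integral>\<^sup>+x\<in>{x \<in> sphere a R. h x = 0}.
             ennreal (f x / norm (tangential_gradient a h x)) \<partial>hausdorff1
      else undefined)"


section \<open>Pulses and waves\<close>

text \<open>\<open>Pulse A \<alpha>\<close> stands for the distribution \<open>A(x) \<delta>(t - \<alpha>(x))\<close>; a wave is a finite
  superposition of pulses.\<close>

datatype pulse = Pulse (amp: "real^3 \<Rightarrow> real") (arr: "real^3 \<Rightarrow> real")

type_synonym wave = "pulse list"

definition dirac_signal :: pulse where
  "dirac_signal = Pulse (\<lambda>x. 1) (\<lambda>x. 0)"

definition green :: "real \<Rightarrow> real^3 \<Rightarrow> pulse" where
  "green c y = Pulse (\<lambda>x. 1 / (4 * pi * norm (x - y))) (\<lambda>x. norm (x - y) / c)"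

text \<open>Convolution in time: \<open>\<delta>(t - \<alpha>) \<star> \<delta>(t - \<beta>) = \<delta>(t - (\<alpha> + \<beta>))\<close>.\<close>

definition time_conv :: "pulse \<Rightarrow> pulse \<Rightarrow> pulse" where
  "time_conv p q = Pulse (\<lambda>x. amp p x * amp q x) (\<lambda>x. arr p x + arr q x)"

definition scale_pulse :: "real \<Rightarrow> pulse \<Rightarrow> pulse" where
  "scale_pulse r p = Pulse (\<lambda>x. r * amp p x) (arr p)"

definition retarded_wave :: "real \<Rightarrow> pulse \<Rightarrow> nat \<Rightarrow> (nat \<Rightarrow> real^3) \<Rightarrow> (nat \<Rightarrow> real) \<Rightarrow> wave" where
  "retarded_wave c sig K s \<tau> =
     map (\<lambda>j. scale_pulse (\<tau> j) (time_conv (green c (s j)) sig)) [1..<Suc K]"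

text \<open>The integral of the product of two pulses over all times and over \<open>sphere a R\<close>. The time
  integral follows the rule \<open>\<integral> \<delta>(t - \<alpha>) \<delta>(t - \<beta>) dt = \<delta>(\<alpha> - \<beta>)\<close>; if both delta factors are
  the same, the product is the square of a delta distribution (with positive coefficient) and is
  assigned the value \<open>\<infinity>\<close>.\<close>

definition pulse_product_integral :: "real^3 \<Rightarrow> real \<Rightarrow> pulse \<Rightarrow> pulse \<Rightarrow> ennreal" where
  "pulse_product_integral a R p q =
     (if arr p = arr q then \<infinity>
      else surface_delta_integral a R (\<lambda>x. amp p x * amp q x) (\<lambda>x. arr p x - arr q x))"

definition wave_product_integral :: "real^3 \<Rightarrow> real \<Rightarrow> wave \<Rightarrow> pulse \<Rightarrow> ennreal" where
  "wave_product_integral a R u q = (\<Sum>p\<leftarrow>u. pulse_product_integral a R p q)"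


section \<open>The wave equation in the sense of distributions\<close>

definition pd :: "'a::real_normed_vector \<Rightarrow> ('a \<Rightarrow> real) \<Rightarrow> 'a \<Rightarrow> real" where
  "pd v \<phi> p = frechet_derivative \<phi> (at p) v"

primrec Ck :: "nat \<Rightarrow> ('a::real_normed_vector \<Rightarrow> real) \<Rightarrow> bool" where
  "Ck 0 \<phi> \<longleftrightarrow> continuous_on UNIV \<phi>"
| "Ck (Suc n) \<phi> \<longleftrightarrow> (\<forall>p. \<phi> differentiable (at p)) \<and> (\<forall>v. Ck n (pd v \<phi>))"

definition test_function :: "('a::real_normed_vector \<Rightarrow> real) \<Rightarrow> bool" where
  "test_function \<phi> \<longleftrightarrow> (\<forall>n. Ck n \<phi>) \<and> compact (closure {p. \<phi> p \<noteq> 0})"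

definition dAlembert :: "real \<Rightarrow> ((real^3) \<times> real \<Rightarrow> real) \<Rightarrow> (real^3) \<times> real \<Rightarrow> real" where
  "dAlembert c \<phi> p =
     pd (0, 1) (pd (0, 1) \<phi>) p / c\<^sup>2 - (\<Sum>b\<in>Basis. pd (b, 0) (pd (b, 0) \<phi>) p)"

definition wave_distribution :: "wave \<Rightarrow> ((real^3) \<times> real \<Rightarrow> real) \<Rightarrow> real" where
  "wave_distribution u \<phi> = (\<Sum>p\<leftarrow>u. \<integral>x. amp p x * \<phi> (x, arr p x) \<partial>lborel)"

text \<open>The source \<open>\<Sum>j=1..K. \<lambda>(t) \<tau>\<^sub>j \<delta>(x - s\<^sub>j)\<close> tested against \<open>\<phi>\<close>, where \<open>\<lambda>\<close> is the pulse \<open>sig\<close>.\<close>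

definition source_distribution ::
    "pulse \<Rightarrow> nat \<Rightarrow> (nat \<Rightarrow> real^3) \<Rightarrow> (nat \<Rightarrow> real) \<Rightarrow> ((real^3) \<times> real \<Rightarrow> real) \<Rightarrow> real" where
  "source_distribution sig K s \<tau> \<phi> =
     (\<Sum>j=1..K. \<tau> j * amp sig (s j) * \<phi> (s j, arr sig (s j)))"

text \<open>The d'Alembert operator is formally self-adjoint, so it is moved to the test function.\<close>

definition causal_solution ::
    "real \<Rightarrow> pulse \<Rightarrow> nat \<Rightarrow> (nat \<Rightarrow> real^3) \<Rightarrow> (nat \<Rightarrow> real) \<Rightarrow> wave \<Rightarrow> bool" where
  "causal_solution c sig K s \<tau> u \<longleftrightarrow>
     (\<forall>\<phi>. test_function \<phi> \<longrightarrow>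
        wave_distribution u (dAlembert c \<phi>) = source_distribution sig K s \<tau> \<phi>) \<and>
     (\<forall>\<phi>. test_function \<phi> \<and> closure {p. \<phi> p \<noteq> 0} \<subseteq> {p. snd p < 0} \<longrightarrow>
        wave_distribution u \<phi> = 0)"

end

theory Submission
  imports Defs
begin

text \<open>The delta distribution in the \<open>j\<close>-th term of the indicator lives on the points of the sphere
  equidistant from \<open>s\<^sub>j\<close> and \<open>z\<close>, which form a circle. The tangential gradient of the delay does not
  vanish on it, so the density is bounded by compactness; as the circle has finite length, the term
  is finite for \<open>z \<noteq> s\<^sub>j\<close>. On the other hand the gradient has norm at most
  \<open>\<bar>z - s\<^sub>j\<bar> / (c \<bar>x - s\<^sub>j\<bar>)\<close>, while for \<open>z\<close> near \<open>s\<^sub>j\<close> the length of the circle stays away from zero,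
  because its projection to a line in its plane covers a segment of fixed length. Hence the term is
  at least a constant multiple of \<open>1 / \<bar>z - s\<^sub>j\<bar>\<close>.

  As \<^const>\<open>measure_of\<close> yields the zero measure when the given set function is not countably additive, all
  of this rests on Caratheodory's criterion for metric outer measures.\<close>

section \<open>Caratheodory's criterion and Hausdorff measure\<close>

text \<open>Superadditivity on sets at positive distance. The reverse inequality is subadditivity,
  which every outer measure has.\<close>

definition metric_additive :: "('a::metric_space set \<Rightarrow> ennreal) \<Rightarrow> bool" where
  "metric_additive \<mu> \<longleftrightarrow>
     (\<forall>A B \<epsilon>. 0 < \<epsilon> \<longrightarrow> (\<forall>x\<in>A. \<forall>y\<in>B. \<epsilon> \<le> dist x y) \<longrightarrow> \<mu> A + \<mu> B \<le> \<mu> (A \<union> B))"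

lemma metric_additiveD:
  assumes "metric_additive \<mu>" "0 < \<epsilon>" "\<And>x y. x \<in> A \<Longrightarrow> y \<in> B \<Longrightarrow> \<epsilon> \<le> dist x y"
  shows "\<mu> A + \<mu> B \<le> \<mu> (A \<union> B)"
  using assms unfolding metric_additive_def by blast

lemma infdist_ge_imp_dist_ge:
  assumes "a \<le> infdist x F" "infdist y F \<le> b"
  shows "a - b \<le> dist x y"
  using infdist_triangle[of x F y] assms by linarith

text \<open>The difference of \<open>T\<close> and \<open>F\<close> is exhausted by the sets \<open>B n\<close> at distance at least \<open>r n\<close>
  from \<open>F\<close>. The layers \<open>P n\<close> have summable measure because \<open>B n\<close> and \<open>P n\<close> are separated, so the
  part of \<open>T - F\<close> outside \<open>B n\<close> becomes negligible.\<close>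

lemma closed_in_lambda_system:
  fixes \<mu> :: "'a::metric_space set \<Rightarrow> ennreal"
  assumes oms: "outer_measure_space (Pow UNIV) \<mu>" and add: "metric_additive \<mu>" and "closed F"
  shows "F \<in> lambda_system UNIV (Pow UNIV) \<mu>"
proof (cases "F = {}")
  case True
  have "positive (Pow UNIV) \<mu>" using oms by (simp add: outer_measure_space_def)
  then show ?thesis
    using algebra.lambda_system_empty[OF algebra_Pow] True by blast
next
  case False
  have pos: "\<mu> {} = 0" and mono: "\<And>A B. A \<subseteq> B \<Longrightarrow> \<mu> A \<le> \<mu> B"
    and csub: "countably_subadditive (Pow UNIV) \<mu>"
    using oms
    by (auto simp: outer_measure_space_def positive_def increasing_def)
  have sub: "subadditive (Pow UNIV) \<mu>"
    using pos csub
    by (intro ring_of_sets.countably_subadditive_subadditive[OF ring_of_sets_Pow])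
      (auto simp: positive_def)
  have sub: "\<mu> (A \<union> B) \<le> \<mu> A + \<mu> B" for A B
  proof -
    have "\<mu> (A \<union> B) = \<mu> (A \<union> (B - A))" by simp
    also have "\<dots> \<le> \<mu> A + \<mu> (B - A)"
      by (rule subadditiveD[OF sub]) auto
    also have "\<dots> \<le> \<mu> A + \<mu> B" by (intro add_left_mono mono) auto
    finally show ?thesis .
  qed
  have main: "\<mu> (T \<inter> F) + \<mu> (T - F) \<le> \<mu> T" for T
  proof (cases "\<mu> T = \<infinity>")
    case True then show ?thesis by simp
  next
    case fin: False
    define r :: "nat \<Rightarrow> real" where "r n = 1 / real (Suc n)" for n
    have rpos: "0 < r n" for n by (simp add: r_def)
    have rdec: "r (Suc n) < r n" for n by (simp add: r_def field_simps)
    have ranti: "m \<le> n \<Longrightarrow> r n \<le> r m" for m n by (simp add: r_def field_simps)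
    define B where "B n = {x\<in>T. r n \<le> infdist x F}" for n
    \<comment> \<open>The layer starts below \<open>r (Suc n)\<close>, not below \<open>r n\<close>.
      The gap \<open>r n - r (Suc n)\<close> is what separates it from \<open>B n\<close>.\<close>
    define P where "P n = {x\<in>T. r (Suc (Suc n)) \<le> infdist x F \<and> infdist x F < r (Suc n)}" for n
    have step: "\<mu> (B n) + \<mu> (P n) \<le> \<mu> (B (Suc (Suc n)))" for n
    proof -
      have "\<mu> (B n) + \<mu> (P n) \<le> \<mu> (B n \<union> P n)"
      proof (rule metric_additiveD[OF add])
        show "0 < r n - r (Suc n)" using rdec[of n] by simp
        show "r n - r (Suc n) \<le> dist x y" if "x \<in> B n" "y \<in> P n" for x y
          using that by (intro infdist_ge_imp_dist_ge[where F = F]) (auto simp: B_def P_def)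
      qed
      also have "\<dots> \<le> \<mu> (B (Suc (Suc n)))"
        using rdec[of n] rdec[of "Suc n"] by (intro mono) (auto simp: B_def P_def)
      finally show ?thesis .
    qed
    have BT: "\<mu> (B n) \<le> \<mu> T" for n by (intro mono) (auto simp: B_def)
    \<comment> \<open>Since \<open>step\<close> raises the index by two, layers of even and of odd
      index accumulate separately. The two terms on the right account for one parity each.\<close>
    have sums: "(\<Sum>k<n. \<mu> (P k)) \<le> \<mu> (B n) + \<mu> (B (Suc n))" for n
    proof (induction n)
      case (Suc n)
      have "(\<Sum>k<Suc n. \<mu> (P k)) \<le> \<mu> (B (Suc n)) + (\<mu> (B n) + \<mu> (P n))"
        using add_right_mono[OF Suc, of "\<mu> (P n)"] by (simp add: ac_simps)
      also have "\<dots> \<le> \<mu> (B (Suc n)) + \<mu> (B (Suc (Suc n)))"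
        using step by (intro add_left_mono)
      finally show ?case .
    qed simp
    define s where "s = (\<Sum>k. \<mu> (P k))"
    have "s \<le> \<mu> T + \<mu> T" unfolding s_def
      by (intro suminf_le_const summableI order.trans[OF sums] add_mono BT)
    then have sfin: "s \<noteq> \<infinity>"
      using fin by (auto simp: top_unique)
    have cover: "T - F \<subseteq> B (Suc n) \<union> (\<Union>k. P (k + n))" for n
    proof
      fix x assume x: "x \<in> T - F"
      have "0 < infdist x F"
        using x False \<open>closed F\<close> by (simp add: infdist_pos_not_in_closed)
      then obtain m where m: "r m < infdist x F"
        unfolding r_def using nat_approx_posE by blast
      \<comment> \<open>This index locates x: it lies in \<open>B (Suc n)\<close> if
        \<open>l\<close> is at most \<open>Suc n\<close>, and otherwise in the layer
        \<open>P (l - 2)\<close>.\<close>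
      define l where "l = (LEAST m. r m \<le> infdist x F)"
      have l: "r l \<le> infdist x F" unfolding l_def by (rule LeastI[of _ m]) (use m in simp)
      show "x \<in> B (Suc n) \<union> (\<Union>k. P (k + n))"
      proof (cases "l \<le> Suc n")
        case True
        then show ?thesis using ranti[OF True] l x by (auto simp: B_def)
      next
        case False
        then obtain k where k: "l = Suc (Suc (k + n))"
          by (metis add.commute add_Suc_right less_natE not_less)
        have "infdist x F < r (Suc (k + n))"
          using not_less_Least[of "Suc (k + n)" "\<lambda>m. r m \<le> infdist x F"] k
          unfolding l_def by auto
        then show ?thesis using l x k by (auto simp: P_def)
      qed
    qed
    have disjP: "disjoint_family (\<lambda>k. P (k + n))" for n
    proof -
      have aux: False if "x \<in> P i" "x \<in> P j" "i < j" for x i j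
        using that ranti[of "Suc (Suc i)" "Suc j"] by (auto simp: P_def)
      show ?thesis
        unfolding disjoint_family_on_def
        by (metis (no_types, lifting) Int_iff all_not_in_conv aux nat_add_left_cancel_less
            add.commute linorder_neqE_nat)
    qed
    \<comment> \<open>Nothing is subtracted in \<open>ennreal\<close>: adding the partial sum
      completes the tail of the series to \<open>s\<close>, and the finite \<open>s\<close> is
      cancelled after passing to the limit.\<close>
    have bound: "\<mu> (T \<inter> F) + \<mu> (T - F) + (\<Sum>k<n. \<mu> (P k)) \<le> \<mu> T + s" for n
    proof -
      have "\<mu> (T - F) \<le> \<mu> (B (Suc n)) + \<mu> (\<Union>k. P (k + n))"
        using mono[OF cover] sub order.trans by blast
      also have "\<dots> \<le> \<mu> (B (Suc n)) + (\<Sum>k. \<mu> (P (k + n)))"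
        using csub disjP[of n] unfolding countably_subadditive_def by (intro add_left_mono) auto
      finally have 1: "\<mu> (T - F) \<le> \<mu> (B (Suc n)) + (\<Sum>k. \<mu> (P (k + n)))" .
      have "\<mu> (T \<inter> F) + \<mu> (B (Suc n)) \<le> \<mu> (T \<inter> F \<union> B (Suc n))"
      proof (rule metric_additiveD[OF add rpos])
        show "r (Suc n) \<le> dist x y" if "x \<in> T \<inter> F" "y \<in> B (Suc n)" for x y
          using infdist_ge_imp_dist_ge[of "r (Suc n)" y F x 0] that
          by (auto simp: B_def dist_commute)
      qed
      also have "\<dots> \<le> \<mu> T" by (intro mono) (auto simp: B_def)
      finally have 2: "\<mu> (T \<inter> F) + \<mu> (B (Suc n)) \<le> \<mu> T" .
      have 3: "(\<Sum>k. \<mu> (P (k + n))) + (\<Sum>k<n. \<mu> (P k)) = s"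
        unfolding s_def
        by (rule suminf_offset[symmetric]) (rule summableI)
      have "\<mu> (T \<inter> F) + \<mu> (T - F) + (\<Sum>k<n. \<mu> (P k))
          \<le> \<mu> (T \<inter> F) + (\<mu> (B (Suc n)) + (\<Sum>k. \<mu> (P (k + n)))) + (\<Sum>k<n. \<mu> (P k))"
        by (intro add_right_mono add_left_mono 1)
      also have "\<dots> = (\<mu> (T \<inter> F) + \<mu> (B (Suc n))) + s"
        unfolding 3[symmetric] by (simp only: ac_simps)
      also have "\<dots> \<le> \<mu> T + s" by (intro add_right_mono 2)
      finally show ?thesis .
    qed
    have "(\<lambda>n. \<mu> (T \<inter> F) + \<mu> (T - F) + (\<Sum>k<n. \<mu> (P k)))
        \<longlonglongrightarrow> \<mu> (T \<inter> F) + \<mu> (T - F) + s"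
      unfolding s_def by (intro tendsto_intros summable_LIMSEQ summableI)
    then have "\<mu> (T \<inter> F) + \<mu> (T - F) + s \<le> \<mu> T + s"
      using bound by (intro LIMSEQ_le_const2) auto
    then show ?thesis
      using sfin by (simp add: ennreal_add_left_cancel_le add.commute)
  qed
  have "\<mu> T \<le> \<mu> (T \<inter> F) + \<mu> (T - F)" for T
    using sub[of "T \<inter> F" "T - F"] by (simp only: Int_Diff_Un)
  with main show ?thesis
    by (subst algebra.lambda_system_eq[OF algebra_Pow]) (auto intro: antisym)
qed

text \<open>The lambda system is a sigma-algebra on which an outer measure is countably additive.
  Containing the closed sets, it contains all Borel sets.\<close>

proposition metric_outer_measure_borel:
  fixes \<mu> :: "'a::metric_space set \<Rightarrow> ennreal"
  assumes oms: "outer_measure_space (Pow UNIV) \<mu>" and add: "metric_additive \<mu>"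
  shows "measure_space UNIV (sets borel) \<mu>"
proof -
  interpret P: sigma_algebra UNIV "Pow UNIV :: 'a set set" by (rule sigma_algebra_Pow)
  have ms: "measure_space UNIV (lambda_system UNIV (Pow UNIV) \<mu>) \<mu>"
    by (rule P.caratheodory_lemma[OF oms])
  have "sigma_sets UNIV (Collect closed) \<subseteq> lambda_system UNIV (Pow UNIV) \<mu>"
    using ms closed_in_lambda_system[OF oms add]
    by (intro sigma_algebra.sigma_sets_subset) (auto simp: measure_space_def)
  moreover have "sets borel = sigma_sets UNIV (Collect closed :: 'a set set)"
    by (simp add: borel_eq_closed)
  ultimately show ?thesis
    using measure_down[OF ms sets.sigma_algebra_axioms[of borel, simplified]] by simp
qed

section \<open>Hausdorff measure as a metric outer measure\<close>

lemma hausdorff1_pre_mono: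
  fixes A B :: "'a::metric_space set"
  assumes "A \<subseteq> B" "\<delta> \<le> \<epsilon>"
  shows "hausdorff1_pre \<epsilon> A \<le> hausdorff1_pre \<delta> B"
  unfolding hausdorff1_pre_def
proof (rule INF_superset_mono)
  show "{C :: nat \<Rightarrow> 'a set. B \<subseteq> (\<Union>i. C i) \<and> (\<forall>i. bounded (C i) \<and> diameter (C i) \<le> \<delta>)}
      \<subseteq> {C. A \<subseteq> (\<Union>i. C i) \<and> (\<forall>i. bounded (C i) \<and> diameter (C i) \<le> \<epsilon>)}"
    using assms by (intro Collect_mono impI conjI allI) (blast intro: order.trans)+
qed simp

lemma hausdorff1_pre_le_outer:
  "0 < \<delta> \<Longrightarrow> hausdorff1_pre \<delta> A \<le> hausdorff1_outer A"
  unfolding hausdorff1_outer_def by (rule SUP_upper) simp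

lemma hausdorff1_pre_le:
  assumes "A \<subseteq> (\<Union>i. C i)" "\<And>i. bounded (C i)" "\<And>i. diameter (C i) \<le> \<delta>"
  shows "hausdorff1_pre \<delta> A \<le> (\<Sum>i. ennreal (diameter (C i)))"
  unfolding hausdorff1_pre_def using assms by (intro INF_lower) auto

lemma hausdorff1_outer_empty: "hausdorff1_outer {} = 0"
proof -
  have "hausdorff1_pre \<delta> ({} :: 'a set) \<le> 0" if "0 < \<delta>" for \<delta>
    using hausdorff1_pre_le[of "{}" "\<lambda>_. {} :: 'a set" \<delta>] that by simp
  then show ?thesis
    unfolding hausdorff1_outer_def by (intro antisym SUP_least) auto
qed

text \<open>Each \<open>A n\<close> gets a cover that is optimal up to \<open>e / 2 ^ Suc n\<close>.
  The double sequence of these covers is enumerated by \<open>prod_decode\<close>, and the errors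
  add up to \<open>e\<close>.\<close>

lemma hausdorff1_pre_countably_subadditive:
  fixes A :: "nat \<Rightarrow> 'a::metric_space set"
  shows "hausdorff1_pre \<delta> (\<Union>n. A n) \<le> (\<Sum>n. hausdorff1_pre \<delta> (A n))"
proof (cases "(\<Sum>n. hausdorff1_pre \<delta> (A n)) = \<infinity>")
  case False
  show ?thesis
  proof (rule ennreal_le_epsilon)
    fix e :: real assume e: "0 < e"
    define g where "g n = e * (1/2) ^ Suc n" for n
    have g: "0 < g n" for n using e by (simp add: g_def)
    have g_sums: "g sums e"
      using sums_mult[OF power_half_series, of e] unfolding g_def by simp
    have "\<exists>C. A n \<subseteq> (\<Union>i. C i) \<and> (\<forall>i. bounded (C i) \<and> diameter (C i) \<le> \<delta>)
        \<and> (\<Sum>i. ennreal (diameter (C i))) \<le> hausdorff1_pre \<delta> (A n) + ennreal (g n)"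
      for n
    proof -
      have "hausdorff1_pre \<delta> (A n) \<noteq> \<infinity>"
        using False ennreal_suminf_lessD[of "\<lambda>n. hausdorff1_pre \<delta> (A n)" \<infinity> n] 
        by (auto simp: less_top)
      then have "\<exists>C\<in>{C. A n \<subseteq> (\<Union>i. C i) \<and> (\<forall>i. bounded (C i) \<and> diameter (C i) \<le> \<delta>)}.
          (\<Sum>i. ennreal (diameter (C i))) < hausdorff1_pre \<delta> (A n) + ennreal (g n)"
        by (rule INF_approx_ennreal[OF g hausdorff1_pre_def])
      then obtain C where C: "C \<in> {C. A n \<subseteq> (\<Union>i. C i) \<and> (\<forall>i. bounded (C i) \<and> diameter (C i) \<le> \<delta>)}"
        and lt: "(\<Sum>i. ennreal (diameter (C i))) < hausdorff1_pre \<delta> (A n) + ennreal (g n)"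
        by (rule bexE)
      show ?thesis
        using CollectD[OF C] less_imp_le[OF lt] by (intro exI[of _ C]) (simp only: simp_thms)
    qed
    then obtain C where C: "\<And>n. A n \<subseteq> (\<Union>i. C n i)" "\<And>n i. bounded (C n i)"
        "\<And>n i. diameter (C n i) \<le> \<delta>"
        "\<And>n. (\<Sum>i. ennreal (diameter (C n i))) \<le> hausdorff1_pre \<delta> (A n) + ennreal (g n)"
      by metis
    define E where "E k = case_prod C (prod_decode k)" for k
    have "(\<Union>n. A n) \<subseteq> (\<Union>k. E k)"
    proof
      fix x assume "x \<in> (\<Union>n. A n)"
      then obtain n i where "x \<in> C n i" using C(1) by blast
      then have "x \<in> E (prod_encode (n, i))" by (simp add: E_def)
      then show "x \<in> (\<Union>k. E k)" by blast
    qed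
    then have "hausdorff1_pre \<delta> (\<Union>n. A n) \<le> (\<Sum>k. ennreal (diameter (E k)))"
      by (rule hausdorff1_pre_le) (auto simp: E_def C split: prod.split)
    also have "\<dots> = (\<Sum>n. \<Sum>i. ennreal (diameter (C n i)))"
      using suminf_ennreal_2dimen[of "\<lambda>n. \<Sum>i. ennreal (diameter (C n i))"
          "\<lambda>(n, i). ennreal (diameter (C n i))"]
      by (simp add: E_def o_def case_prod_beta)
    also have "\<dots> \<le> (\<Sum>n. hausdorff1_pre \<delta> (A n) + ennreal (g n))"
      by (intro suminf_le C summableI)
    also have "\<dots> = (\<Sum>n. hausdorff1_pre \<delta> (A n)) + (\<Sum>n. ennreal (g n))"
      by (intro suminf_add[symmetric] summableI)
    also have "(\<Sum>n. ennreal (g n)) = ennreal e"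
      by (rule suminf_ennreal_eq[OF less_imp_le[OF g] g_sums])
    finally show "hausdorff1_pre \<delta> (\<Union>n. A n) \<le> (\<Sum>n. hausdorff1_pre \<delta> (A n)) + ennreal e" .
  qed
qed simp

lemma hausdorff1_outer_measure_space: "outer_measure_space (Pow UNIV) hausdorff1_outer"
  unfolding outer_measure_space_def
proof (intro conjI)
  show "positive (Pow UNIV) hausdorff1_outer"
    by (simp add: positive_def hausdorff1_outer_empty)
  show "increasing (Pow UNIV) hausdorff1_outer"
    unfolding increasing_def hausdorff1_outer_def
    by (auto intro!: SUP_mono' hausdorff1_pre_mono)
  have "hausdorff1_outer (\<Union>n. A n) \<le> (\<Sum>n. hausdorff1_outer (A n))"
    for A :: "nat \<Rightarrow> 'a set"
    unfolding hausdorff1_outer_def[of "\<Union>n. A n"]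
    by (intro SUP_least order.trans[OF hausdorff1_pre_countably_subadditive] suminf_le summableI
        hausdorff1_pre_le_outer) auto
  then show "countably_subadditive (Pow (UNIV :: 'a set)) hausdorff1_outer"
    by (auto simp: countably_subadditive_def)
qed

text \<open>A set of diameter at most \<delta> cannot meet both A and B. Hence a cover of the union
  contains disjoint subfamilies covering A and B.\<close>

lemma hausdorff1_pre_separated:
  fixes A B :: "'a::metric_space set"
  assumes sep: "\<And>x y. x \<in> A \<Longrightarrow> y \<in> B \<Longrightarrow> \<epsilon> \<le> dist x y" and "\<delta> < \<epsilon>"
  shows "hausdorff1_pre \<delta> A + hausdorff1_pre \<delta> B \<le> hausdorff1_pre \<delta> (A \<union> B)"
  unfolding hausdorff1_pre_def[of \<delta> "A \<union> B"]
proof (rule INF_greatest, clarify)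
  fix C :: "nat \<Rightarrow> 'a set"
  assume AB: "A \<union> B \<subseteq> (\<Union>i. C i)" and C: "\<forall>i. bounded (C i) \<and> diameter (C i) \<le> \<delta>"
  \<comment> \<open>Members that miss the given set are replaced by the empty set, whose diameter 0
    must also respect the bound \<delta>.\<close>
  then have \<delta>: "0 \<le> \<delta>" using diameter_ge_0 order.trans by blast
  define D where "D X i = (if C i \<inter> X = {} then {} else C i)" for X i
  have D: "hausdorff1_pre \<delta> X \<le> (\<Sum>i. ennreal (diameter (D X i)))" if "X \<subseteq> A \<union> B" for X
  proof (rule hausdorff1_pre_le)
    show "X \<subseteq> (\<Union>i. D X i)" using that AB by (fastforce simp: D_def)
  qed (use C \<delta> in \<open>auto simp: D_def\<close>)
  have "hausdorff1_pre \<delta> A + hausdorff1_pre \<delta> B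
      \<le> (\<Sum>i. ennreal (diameter (D A i))) + (\<Sum>i. ennreal (diameter (D B i)))"
    by (intro add_mono D) auto
  also have "\<dots> = (\<Sum>i. ennreal (diameter (D A i)) + ennreal (diameter (D B i)))"
    by (intro suminf_add summableI)
  also have "\<dots> \<le> (\<Sum>i. ennreal (diameter (C i)))"
  proof (intro suminf_le summableI)
    fix i
    have "C i \<inter> A = {} \<or> C i \<inter> B = {}"
    proof (rule ccontr)
      assume "\<not> ?thesis"
      then obtain x y where xy: "x \<in> C i" "x \<in> A" "y \<in> C i" "y \<in> B" by blast
      then have "dist x y \<le> diameter (C i)" using C by (intro diameter_bounded_bound) auto
      then show False using sep[OF xy(2,4)] C \<open>\<delta> < \<epsilon>\<close> by (meson not_le order.trans)
    qed
    then show "ennreal (diameter (D A i)) + ennreal (diameter (D B i)) \<le> ennreal (diameter (C i))"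
      by (auto simp: D_def)
  qed
  finally show "hausdorff1_pre \<delta> A + hausdorff1_pre \<delta> B \<le> (\<Sum>i. ennreal (diameter (C i)))" .
qed

text \<open>The scales for A and B are independent, so that the two suprema can be taken one after
  the other. Each pair is refined to a common scale below \<epsilon>, which only increases both
  values.\<close>

lemma hausdorff1_outer_metric_additive: "metric_additive hausdorff1_outer"
  unfolding metric_additive_def
proof (intro allI impI)
  fix A B :: "'a set" and \<epsilon> :: real
  assume \<epsilon>: "0 < \<epsilon>" and sep: "\<forall>x\<in>A. \<forall>y\<in>B. \<epsilon> \<le> dist x y"
  have *: "hausdorff1_pre \<delta> A + hausdorff1_pre \<eta> B \<le> hausdorff1_outer (A \<union> B)"
    if "0 < \<delta>" "0 < \<eta>" for \<delta> \<eta>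
  proof -
    define \<theta> where "\<theta> = min (min \<delta> \<eta>) (\<epsilon> / 2)"
    have \<theta>: "0 < \<theta>" "\<theta> \<le> \<delta>" "\<theta> \<le> \<eta>" "\<theta> < \<epsilon>" using that \<epsilon> by (auto simp: \<theta>_def)
    have "hausdorff1_pre \<delta> A + hausdorff1_pre \<eta> B \<le> hausdorff1_pre \<theta> A + hausdorff1_pre \<theta> B"
      using \<theta> by (intro add_mono hausdorff1_pre_mono) auto
    also have "\<dots> \<le> hausdorff1_pre \<theta> (A \<union> B)"
      using sep \<theta> by (intro hausdorff1_pre_separated) auto
    also have "\<dots> \<le> hausdorff1_outer (A \<union> B)" using \<theta> by (intro hausdorff1_pre_le_outer)
    finally show ?thesis .
  qed
  have ne: "{0::real<..} \<noteq> {}" by (metis all_not_in_conv greaterThan_iff zero_less_one)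
  have "hausdorff1_pre \<delta> A + hausdorff1_outer B \<le> hausdorff1_outer (A \<union> B)" if "0 < \<delta>" for \<delta>
    unfolding hausdorff1_outer_def[of B] ennreal_SUP_add_right[OF ne]
    using * that by (intro SUP_least) auto
  then show "hausdorff1_outer A + hausdorff1_outer B \<le> hausdorff1_outer (A \<union> B)"
    unfolding hausdorff1_outer_def[of A] ennreal_SUP_add_left[OF ne, symmetric]
    by (intro SUP_least) auto
qed

lemma sets_hausdorff1 [simp]: "sets hausdorff1 = sets borel"
  using sets.sigma_sets_eq[of borel] by (auto simp: hausdorff1_def)

text \<open>Transfers the bounds on \<open>hausdorff1_outer\<close> proved below to integrals
  against \<open>hausdorff1\<close>.\<close>

lemma emeasure_hausdorff1:
  assumes "A \<in> sets borel"
  shows "emeasure hausdorff1 A = hausdorff1_outer A"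
  unfolding hausdorff1_def
  using metric_outer_measure_borel[OF hausdorff1_outer_measure_space hausdorff1_outer_metric_additive]
  by (intro emeasure_measure_of_sigma assms) (auto simp: measure_space_def)

section \<open>Length of curves and circles\<close>

text \<open>A map that does not increase distances sends each covering set into an interval no
  longer than its diameter. Lebesgue measure then bounds the sum of the diameters from below,
  already for covers at scale 1.\<close>

lemma hausdorff1_outer_ge_projection:
  fixes f :: "'a::metric_space \<Rightarrow> real"
  assumes lip: "\<And>x y. dist (f x) (f y) \<le> dist x y" and sub: "{\<alpha>..\<beta>} \<subseteq> f ` A" and "\<alpha> \<le> \<beta>"
  shows "ennreal (\<beta> - \<alpha>) \<le> hausdorff1_outer A"
proof -
  have "ennreal (\<beta> - \<alpha>) \<le> hausdorff1_pre 1 A"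
    unfolding hausdorff1_pre_def
  proof (rule INF_greatest, clarify)
    fix C :: "nat \<Rightarrow> 'a set"
    assume A: "A \<subseteq> (\<Union>i. C i)" and C: "\<forall>i. bounded (C i) \<and> diameter (C i) \<le> 1"
    \<comment> \<open>The image itself need not be Borel, so it is enclosed in the interval from its
      infimum to its supremum.\<close>
    have "\<exists>l u. f ` C i \<subseteq> {l..u} \<and> 0 \<le> u - l \<and> u - l \<le> diameter (C i)" for i
    proof (cases "C i = {}")
      case False
      have fC: "f x \<le> f y + diameter (C i)" if "x \<in> C i" "y \<in> C i" for x y
        using lip[of x y] diameter_bounded_bound[of "C i" x y] C that by (auto simp: dist_real_def)
      obtain x0 where x0: "x0 \<in> C i" using False by blast
      have bb: "bdd_below (f ` C i)" "bdd_above (f ` C i)"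
        using fC[OF x0] fC[OF _ x0]
        by (auto intro!: bdd_belowI[of _ "f x0 - diameter (C i)"]
            bdd_aboveI[of _ "f x0 + diameter (C i)"] simp: algebra_simps)
      have "f x - diameter (C i) \<le> Inf (f ` C i)" if "x \<in> C i" for x
        using fC[OF that] False by (intro cINF_greatest) (auto simp: algebra_simps)
      then have "Sup (f ` C i) \<le> Inf (f ` C i) + diameter (C i)"
        using False by (intro cSUP_least) (auto simp: algebra_simps)
      moreover have "f ` C i \<subseteq> {Inf (f ` C i)..Sup (f ` C i)}"
        using bb by (auto intro: cINF_lower cSUP_upper)
      moreover have "Inf (f ` C i) \<le> Sup (f ` C i)"
        using bb x0 by (meson cINF_lower cSUP_upper order.trans)
      ultimately show ?thesis by (intro exI[of _ "Inf (f ` C i)"] exI[of _ "Sup (f ` C i)"]) auto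
    qed (auto intro: exI[of _ 0])
    then obtain l u where lu: "\<And>i. f ` C i \<subseteq> {l i..u i}" "\<And>i. 0 \<le> u i - l i"
        "\<And>i. u i - l i \<le> diameter (C i)"
      by metis
    have "ennreal (\<beta> - \<alpha>) = emeasure lborel {\<alpha>..\<beta>}" using \<open>\<alpha> \<le> \<beta>\<close> by simp
    also have "\<dots> \<le> emeasure lborel (\<Union>i. {l i..u i})"
    proof (rule emeasure_mono)
      have "{\<alpha>..\<beta>} \<subseteq> (\<Union>i. f ` C i)" using sub image_mono[OF A, of f] unfolding image_UN
        by (rule order.trans)
      also have "\<dots> \<subseteq> (\<Union>i. {l i..u i})" by (intro UN_mono lu(1) order.refl)
      finally show "{\<alpha>..\<beta>} \<subseteq> (\<Union>i. {l i..u i})" .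
    qed auto
    also have "\<dots> \<le> (\<Sum>i. emeasure lborel {l i..u i})"
      by (rule emeasure_subadditive_countably) auto
    also have "\<dots> \<le> (\<Sum>i. ennreal (diameter (C i)))"
      using lu(2,3) by (intro suminf_le summableI) (simp add: ennreal_leI)
    finally show "ennreal (\<beta> - \<alpha>) \<le> (\<Sum>i. ennreal (diameter (C i)))" .
  qed
  also have "\<dots> \<le> hausdorff1_outer A" by (rule hausdorff1_pre_le_outer) simp
  finally show ?thesis .
qed

text \<open>The images of N equal parameter intervals of length \<open>h\<close> have diameter at
  most \<open>L * h\<close>. Large N brings this below any \<delta>, while the total
  \<open>N * L * h\<close> stays equal to \<open>L * (\<beta> - \<alpha>)\<close>.\<close>

lemma hausdorff1_outer_lipschitz_curve:
  fixes \<gamma> :: "real \<Rightarrow> 'a::metric_space"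
  assumes lip: "L-lipschitz_on {\<alpha>..\<beta>} \<gamma>" and "\<alpha> < \<beta>"
  shows "hausdorff1_outer (\<gamma> ` {\<alpha>..\<beta>}) \<le> ennreal (L * (\<beta> - \<alpha>))"
  unfolding hausdorff1_outer_def
proof (rule SUP_least)
  fix \<delta> :: real assume "\<delta> \<in> {0<..}"
  then have \<delta>: "0 < \<delta>" by simp
  have L: "0 \<le> L" using lip by (rule lipschitz_on_nonneg)
  obtain N0 :: nat where "L * (\<beta> - \<alpha>) / \<delta> < real N0" using reals_Archimedean2 by blast
  then obtain N :: nat where N: "0 < N" "L * (\<beta> - \<alpha>) / \<delta> \<le> real N"
    by (metis less_eq_real_def of_nat_0_less_iff of_nat_le_iff order.strict_trans2 zero_less_one
        of_nat_less_iff less_Suc_eq_le zero_less_Suc order.strict_trans lessI)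
  define h where "h = (\<beta> - \<alpha>) / real N"
  have h: "0 < h" "real N * h = \<beta> - \<alpha>" using N \<open>\<alpha> < \<beta>\<close> by (auto simp: h_def)
  have Lh: "L * h \<le> \<delta>" using N \<delta> by (simp add: h_def field_simps)
  define C where "C i = (if i < N then \<gamma> ` ({\<alpha> + real i * h..\<alpha> + (real i + 1) * h} \<inter> {\<alpha>..\<beta>}) else {})"
    for i
  have CL: "dist x y \<le> L * h" if "x \<in> C i" "y \<in> C i" for i x y
  proof -
    obtain p q where pq: "x = \<gamma> p" "y = \<gamma> q" "p \<in> {\<alpha>..\<beta>}" "q \<in> {\<alpha>..\<beta>}"
        "p \<in> {\<alpha> + real i * h..\<alpha> + (real i + 1) * h}" "q \<in> {\<alpha> + real i * h..\<alpha> + (real i + 1) * h}"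
      using \<open>x \<in> C i\<close> \<open>y \<in> C i\<close> by (auto simp: C_def split: if_splits)
    have "dist p q \<le> h" using pq(5,6) by (auto simp: dist_real_def abs_le_iff algebra_simps)
    then show ?thesis
      using lipschitz_onD[OF lip pq(3,4)] L pq(1,2) by (meson mult_left_mono order.trans)
  qed
  have bnd: "bounded (C i)" for i
    using CL by (auto simp: bounded_two_points)
  have diam: "diameter (C i) \<le> (if i < N then L * h else 0)" for i
  proof (cases "i < N")
    case True
    have "0 \<le> L * h" using L h by simp
    then show ?thesis
      using True CL by (auto simp: diameter_def intro!: cSUP_least)
  qed (simp add: C_def)
  have diam_\<delta>: "diameter (C i) \<le> \<delta>" for i
    using diam[of i] Lh \<delta> by (auto split: if_splits)
  have "\<gamma> ` {\<alpha>..\<beta>} \<subseteq> (\<Union>i. C i)"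
  proof clarify
    fix t assume t: "t \<in> {\<alpha>..\<beta>}"
    show "\<gamma> t \<in> (\<Union>i. C i)"
    proof (cases "t = \<beta>")
      \<comment> \<open>Here the floor used in the other case would give the index N, one past the
        last piece.\<close>
      case True
      have "\<beta> \<in> {\<alpha> + real (N - 1) * h..\<alpha> + (real (N - 1) + 1) * h}"
        using h N(1) by (auto simp: of_nat_diff algebra_simps)
      then have "\<gamma> t \<in> C (N - 1)" using True t N(1) by (auto simp: C_def)
      then show ?thesis by blast
    next
      case False
      define i where "i = nat \<lfloor>(t - \<alpha>) / h\<rfloor>"
      have i: "real i \<le> (t - \<alpha>) / h" "(t - \<alpha>) / h \<le> real i + 1"
        using t h by (auto simp: i_def)
      have "real i * h \<le> t - \<alpha>" using i(1) h by (simp add: field_simps)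
      also have "\<dots> < real N * h" using t False h(2) by auto
      finally have "i < N" using h(1) by (simp only: mult_less_cancel_right_pos of_nat_less_iff)
      moreover have "t \<in> {\<alpha> + real i * h..\<alpha> + (real i + 1) * h}"
        using i h by (auto simp: field_simps)
      ultimately have "\<gamma> t \<in> C i" using t by (auto simp: C_def)
      then show ?thesis by blast
    qed
  qed
  then have "hausdorff1_pre \<delta> (\<gamma> ` {\<alpha>..\<beta>}) \<le> (\<Sum>i. ennreal (diameter (C i)))"
    by (intro hausdorff1_pre_le bnd diam_\<delta>)
  also have "\<dots> \<le> (\<Sum>i. ennreal (if i < N then L * h else 0))"
    by (intro suminf_le summableI ennreal_leI diam)
  also have "\<dots> = (\<Sum>i<N. ennreal (L * h))"
    by (subst suminf_finite[of "{..<N}"]) auto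
  also have "\<dots> = ennreal (L * (\<beta> - \<alpha>))"
    using L h by (simp add: ennreal_of_nat_eq_real_of_nat ennreal_mult[symmetric] mult_ac)
  finally show "hausdorff1_pre \<delta> (\<gamma> ` {\<alpha>..\<beta>}) \<le> ennreal (L * (\<beta> - \<alpha>))" .
qed

section \<open>Circles of equidistant points on a sphere\<close>

lemma orthonormal_frame3:
  fixes n :: "real^3"
  assumes "norm n = 1"
  obtains e1 e2 where "norm e1 = 1" "norm e2 = 1" "e1 \<bullet> n = 0" "e2 \<bullet> n = 0" "e1 \<bullet> e2 = 0"
    "\<And>x. x = (x \<bullet> n) *\<^sub>R n + (x \<bullet> e1) *\<^sub>R e1 + (x \<bullet> e2) *\<^sub>R e2"
proof -
  let ?H = "{x. n \<bullet> x = 0}"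
  obtain B where B: "B \<subseteq> ?H" "pairwise orthogonal B" "\<And>x. x \<in> B \<Longrightarrow> norm x = 1"
      "card B = dim ?H" "span B = ?H"
    using orthonormal_basis_subspace[OF subspace_hyperplane] by metis
  have "n \<noteq> 0" using assms by auto
  then have "card B = 2" using B(4) dim_hyperplane[of n] by simp
  then obtain e1 e2 where e: "B = {e1, e2}" "e1 \<noteq> e2" by (meson card_2_iff)
  have o: "norm e1 = 1" "norm e2 = 1" "e1 \<bullet> n = 0" "e2 \<bullet> n = 0" "e1 \<bullet> e2 = 0"
    using B e by (auto simp: pairwise_def orthogonal_def inner_commute)
  have nn: "n \<bullet> n = 1" "e1 \<bullet> e1 = 1" "e2 \<bullet> e2 = 1"
    using o assms by (auto simp: norm_eq_1)
  have "x = (x \<bullet> n) *\<^sub>R n + (x \<bullet> e1) *\<^sub>R e1 + (x \<bullet> e2) *\<^sub>R e2" for x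
  proof -
    have "x - (x \<bullet> n) *\<^sub>R n \<in> span B"
      using B(5) nn by (simp add: inner_diff_right inner_commute)
    then obtain \<alpha> \<beta> where "x - (x \<bullet> n) *\<^sub>R n = \<alpha> *\<^sub>R e1 + \<beta> *\<^sub>R e2"
      unfolding e by (auto simp: span_insert span_singleton algebra_simps)
    then have x: "x = (x \<bullet> n) *\<^sub>R n + \<alpha> *\<^sub>R e1 + \<beta> *\<^sub>R e2" by (simp add: algebra_simps)
    have "n \<bullet> e1 = 0" "n \<bullet> e2 = 0" "e2 \<bullet> e1 = 0" using o by (simp_all add: inner_commute)
    note ip = this o nn
    have "x \<bullet> e1 = \<alpha>"
      by (rule trans[OF arg_cong[OF x, of "\<lambda>y. y \<bullet> e1"]]) (simp add: inner_add_left ip)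
    moreover have "x \<bullet> e2 = \<beta>"
      by (rule trans[OF arg_cong[OF x, of "\<lambda>y. y \<bullet> e2"]]) (simp add: inner_add_left ip)
    ultimately show ?thesis using x by (simp only:)
  qed
  with o show ?thesis by (rule that)
qed

text \<open>In the difference of the squared distances the quadratic terms in x cancel, which leaves
  twice the inner product on the right.\<close>

lemma equidistant_iff:
  fixes x y z :: "'a::real_inner"
  shows "norm (x - y) = norm (x - z) \<longleftrightarrow> (x - midpoint y z) \<bullet> (z - y) = 0"
proof -
  have "(norm (x - y))\<^sup>2 - (norm (x - z))\<^sup>2 = 2 * ((x - midpoint y z) \<bullet> (z - y))"
    by (simp add: power2_norm_eq_inner midpoint_def algebra_simps inner_commute)
  then show ?thesis by (metis diff_eq_diff_eq eq_iff_diff_eq_0 mult_eq_0_iff norm_ge_zero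
      power2_eq_iff_nonneg zero_neq_numeral)
qed

text \<open>For \<open>s \<noteq> z\<close> this is the section of the sphere by the perpendicular
  bisector plane of s and z; it may be a single point or empty. For \<open>s = z\<close> it is the
  whole sphere.\<close>

definition equidistant_circle :: "real^3 \<Rightarrow> real \<Rightarrow> real^3 \<Rightarrow> real^3 \<Rightarrow> (real^3) set" where
  "equidistant_circle a R s z = {x \<in> sphere a R. norm (x - s) = norm (x - z)}"

lemma compact_equidistant_circle: "compact (equidistant_circle a R s z)"
proof -
  have "equidistant_circle a R s z = sphere a R \<inter> {x. norm (x - s) = norm (x - z)}"
    by (auto simp: equidistant_circle_def)
  moreover have "closed {x. norm (x - s) = norm (x - z)}"
    by (intro closed_Collect_eq continuous_intros)
  ultimately show ?thesis by (simp add: compact_Int_closed)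
qed

text \<open>With n normal to the bisector plane, the plane fixes the n-coordinate and the sphere
  leaves a circle equation in the other two. The guard \<open>0 \<le> R\<close> covers negative
  radii, for which the sphere is empty.\<close>

lemma equidistant_circle_parametrization:
  fixes s z a :: "real^3"
  assumes "s \<noteq> z"
  obtains n e1 e2 where "norm n = 1" "norm e1 = 1" "norm e2 = 1" "e1 \<bullet> n = 0" "e1 \<bullet> e2 = 0"
    "equidistant_circle a R s z =
      {a + ((midpoint s z - a) \<bullet> n) *\<^sub>R n + u *\<^sub>R e1 + v *\<^sub>R e2 | u v.
        0 \<le> R \<and> u\<^sup>2 + v\<^sup>2 = R\<^sup>2 - ((midpoint s z - a) \<bullet> n)\<^sup>2}"
proof -
  define n where "n = sgn (z - s)"
  have n: "norm n = 1" using assms by (simp add: n_def norm_sgn)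
  have zs: "z - s = norm (z - s) *\<^sub>R n" using assms by (simp add: n_def sgn_div_norm)
  obtain e1 e2 where e: "norm e1 = 1" "norm e2 = 1" "e1 \<bullet> n = 0" "e2 \<bullet> n = 0" "e1 \<bullet> e2 = 0"
      "\<And>x. x = (x \<bullet> n) *\<^sub>R n + (x \<bullet> e1) *\<^sub>R e1 + (x \<bullet> e2) *\<^sub>R e2"
    using orthonormal_frame3[OF n] by blast
  define q where "q = (midpoint s z - a) \<bullet> n"
  have ip: "n \<bullet> n = 1" "e1 \<bullet> e1 = 1" "e2 \<bullet> e2 = 1" "n \<bullet> e1 = 0" "n \<bullet> e2 = 0" "e2 \<bullet> e1 = 0"
    using e n by (auto simp: norm_eq_1 inner_commute)
  have plane: "norm (x - s) = norm (x - z) \<longleftrightarrow> (x - a) \<bullet> n = q" for x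
  proof -
    have "norm (x - s) = norm (x - z) \<longleftrightarrow> (x - midpoint s z) \<bullet> n = 0"
      unfolding equidistant_iff using assms by (subst zs) auto
    also have "\<dots> \<longleftrightarrow> (x - a) \<bullet> n = q" by (auto simp: q_def inner_diff_left)
    finally show ?thesis .
  qed
  have nrm: "(norm (p *\<^sub>R n + u *\<^sub>R e1 + v *\<^sub>R e2))\<^sup>2 = p\<^sup>2 + (u\<^sup>2 + v\<^sup>2)" for p u v
    unfolding power2_norm_eq_inner
    by (simp add: inner_add_left inner_add_right ip e power2_eq_square)
  have "equidistant_circle a R s z =
      {a + q *\<^sub>R n + u *\<^sub>R e1 + v *\<^sub>R e2 | u v. 0 \<le> R \<and> u\<^sup>2 + v\<^sup>2 = R\<^sup>2 - q\<^sup>2}" (is "?L = ?X")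
  proof (intro set_eqI iffI)
    fix x assume "x \<in> ?L"
    then have x: "norm (x - a) = R" "(x - a) \<bullet> n = q"
      by (auto simp: equidistant_circle_def plane dist_norm norm_minus_commute)
    define u v where "u = (x - a) \<bullet> e1" and "v = (x - a) \<bullet> e2"
    have xa: "x - a = q *\<^sub>R n + u *\<^sub>R e1 + v *\<^sub>R e2"
      using e(6)[of "x - a"] x by (simp add: u_def v_def)
    have "R\<^sup>2 = q\<^sup>2 + (u\<^sup>2 + v\<^sup>2)" using nrm[of q u v] x xa by simp
    moreover have "x = a + q *\<^sub>R n + u *\<^sub>R e1 + v *\<^sub>R e2" using xa by (simp add: algebra_simps)
    moreover have "0 \<le> R" using x by auto
    ultimately show "x \<in> ?X" by fastforce
  next
    fix x assume "x \<in> ?X"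
    then obtain u v where x: "x = a + q *\<^sub>R n + u *\<^sub>R e1 + v *\<^sub>R e2" and R: "0 \<le> R" "u\<^sup>2 + v\<^sup>2 = R\<^sup>2 - q\<^sup>2"
      by blast
    have xa: "x - a = q *\<^sub>R n + u *\<^sub>R e1 + v *\<^sub>R e2" using x by simp
    have "(norm (x - a))\<^sup>2 = R\<^sup>2" unfolding xa nrm R by simp
    then have "norm (x - a) = R" using R by simp
    moreover have "(x - a) \<bullet> n = q" unfolding xa by (simp add: inner_add_left ip e)
    ultimately show "x \<in> ?L"
      by (simp add: equidistant_circle_def plane dist_norm norm_minus_commute)
  qed
  then show ?thesis using that n e unfolding q_def by blast
qed

lemma hausdorff1_equidistant_circle_finite:
  fixes s z a :: "real^3"
  assumes "s \<noteq> z"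
  shows "hausdorff1_outer (equidistant_circle a R s z) < \<infinity>"
proof -
  obtain n e1 e2 where e: "norm n = 1" "norm e1 = 1" "norm e2 = 1" "e1 \<bullet> n = 0" "e1 \<bullet> e2 = 0"
    and C: "equidistant_circle a R s z =
      {a + ((midpoint s z - a) \<bullet> n) *\<^sub>R n + u *\<^sub>R e1 + v *\<^sub>R e2 | u v.
        0 \<le> R \<and> u\<^sup>2 + v\<^sup>2 = R\<^sup>2 - ((midpoint s z - a) \<bullet> n)\<^sup>2}"
    using equidistant_circle_parametrization[OF assms] by blast
  define q where "q = (midpoint s z - a) \<bullet> n"
  \<comment> \<open>If the plane misses the sphere, the radicand is negative and so is \<rho>,
    because \<open>sqrt\<close> is extended as an odd function. This is why absolute values appear
    below.\<close>
  define \<rho> where "\<rho> = sqrt (R\<^sup>2 - q\<^sup>2)"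
  define \<gamma> where "\<gamma> t = a + q *\<^sub>R n + (\<rho> * cos t) *\<^sub>R e1 + (\<rho> * sin t) *\<^sub>R e2" for t
  have sub: "equidistant_circle a R s z \<subseteq> \<gamma> ` {0..2 * pi}"
  proof
    fix x assume "x \<in> equidistant_circle a R s z"
    then obtain u v where x: "x = a + q *\<^sub>R n + u *\<^sub>R e1 + v *\<^sub>R e2" and uv: "u\<^sup>2 + v\<^sup>2 = R\<^sup>2 - q\<^sup>2"
      using C unfolding q_def by blast
    have \<rho>: "\<rho> = sqrt (u\<^sup>2 + v\<^sup>2)" by (simp add: \<rho>_def uv)
    have "\<exists>t\<in>{0..2 * pi}. u = \<rho> * cos t \<and> v = \<rho> * sin t"
    proof (cases "\<rho> = 0")
      case True
      then have "u = 0" "v = 0" using \<rho> by (auto simp: sum_power2_eq_zero_iff)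
      then show ?thesis using True by (auto intro!: bexI[of _ 0])
    next
      case False
      have "(u / \<rho>)\<^sup>2 + (v / \<rho>)\<^sup>2 = (u\<^sup>2 + v\<^sup>2) / \<rho>\<^sup>2"
        by (simp add: power_divide add_divide_distrib)
      also have "\<dots> = 1" using False \<rho> by simp
      finally obtain t where "0 \<le> t" "t < 2 * pi" "u / \<rho> = cos t" "v / \<rho> = sin t"
        using sincos_total_2pi by metis
      then show ?thesis using False by (auto simp: field_simps intro!: bexI[of _ t])
    qed
    then show "x \<in> \<gamma> ` {0..2 * pi}" using x by (auto simp: \<gamma>_def)
  qed
  \<comment> \<open>The factor 2 comes from estimating the cosine and sine components separately; it
    is harmless, as only finiteness of the length is claimed.\<close>
  have "(2 * \<bar>\<rho>\<bar>)-lipschitz_on {0..2 * pi} \<gamma>"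
  proof (rule lipschitz_onI)
    fix t t' :: real
    have lip: "\<bar>cos t - cos t'\<bar> \<le> \<bar>t - t'\<bar>" "\<bar>sin t - sin t'\<bar> \<le> \<bar>t - t'\<bar>"
      using field_differentiable_bound[of UNIV cos "\<lambda>x. - sin x" 1 t t']
        field_differentiable_bound[of UNIV sin cos 1 t t']
      by (auto intro!: derivative_eq_intros)
    have "\<gamma> t - \<gamma> t' = (\<rho> * (cos t - cos t')) *\<^sub>R e1 + (\<rho> * (sin t - sin t')) *\<^sub>R e2"
      by (simp add: \<gamma>_def algebra_simps)
    then have "dist (\<gamma> t) (\<gamma> t') \<le> \<bar>\<rho>\<bar> * \<bar>cos t - cos t'\<bar> + \<bar>\<rho>\<bar> * \<bar>sin t - sin t'\<bar>"
      using norm_triangle_ineq[of "(\<rho> * (cos t - cos t')) *\<^sub>R e1" "(\<rho> * (sin t - sin t')) *\<^sub>R e2"]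
      by (simp add: dist_norm e abs_mult)
    also have "\<dots> \<le> \<bar>\<rho>\<bar> * \<bar>t - t'\<bar> + \<bar>\<rho>\<bar> * \<bar>t - t'\<bar>"
      by (intro add_mono mult_left_mono lip) auto
    finally show "dist (\<gamma> t) (\<gamma> t') \<le> 2 * \<bar>\<rho>\<bar> * dist t t'" by (simp add: dist_real_def)
  qed simp
  then have "hausdorff1_outer (\<gamma> ` {0..2 * pi}) \<le> ennreal (2 * \<bar>\<rho>\<bar> * (2 * pi - 0))"
    by (rule hausdorff1_outer_lipschitz_curve) simp
  moreover have "hausdorff1_outer (equidistant_circle a R s z) \<le> hausdorff1_outer (\<gamma> ` {0..2 * pi})"
    using hausdorff1_outer_measure_space sub
    by (auto simp: outer_measure_space_def increasing_def)
  ultimately show ?thesis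
    by (metis ennreal_less_top infinity_ennreal_def order.strict_trans1)
qed

text \<open>By Cauchy-Schwarz the bisector plane has distance at most b from the center, so the
  radius of the circle is at least \<open>sqrt (R\<^sup>2 - b\<^sup>2)\<close>. Projection to the
  line along \<open>e1\<close> covers a segment of twice that length. The bound depends on s and z
  only through b.\<close>

lemma hausdorff1_equidistant_circle_ge:
  fixes s z a :: "real^3"
  assumes "s \<noteq> z" and mid: "norm (midpoint s z - a) \<le> b" and "b \<le> R"
  shows "ennreal (2 * sqrt (R\<^sup>2 - b\<^sup>2)) \<le> hausdorff1_outer (equidistant_circle a R s z)"
proof -
  obtain n e1 e2 where e: "norm n = 1" "norm e1 = 1" "norm e2 = 1" "e1 \<bullet> n = 0" "e1 \<bullet> e2 = 0"
    and C: "equidistant_circle a R s z =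
      {a + ((midpoint s z - a) \<bullet> n) *\<^sub>R n + u *\<^sub>R e1 + v *\<^sub>R e2 | u v.
        0 \<le> R \<and> u\<^sup>2 + v\<^sup>2 = R\<^sup>2 - ((midpoint s z - a) \<bullet> n)\<^sup>2}"
    using equidistant_circle_parametrization[OF assms(1)] by blast
  define q where "q = (midpoint s z - a) \<bullet> n"
  have b: "0 \<le> b" "0 \<le> R"
    using mid \<open>b \<le> R\<close> norm_ge_zero[of "midpoint s z - a"] by linarith+
  have "\<bar>q\<bar> \<le> b" using Cauchy_Schwarz_ineq2[of "midpoint s z - a" n] e mid by (simp add: q_def)
  then have qb: "q\<^sup>2 \<le> b\<^sup>2" using b by (simp add: abs_le_square_iff[symmetric])
  have bR: "b\<^sup>2 \<le> R\<^sup>2" using b \<open>b \<le> R\<close> by (simp add: power_mono)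
  define \<rho> where "\<rho> = sqrt (R\<^sup>2 - b\<^sup>2)"
  have \<rho>: "0 \<le> \<rho>" "\<rho>\<^sup>2 = R\<^sup>2 - b\<^sup>2" using bR by (auto simp: \<rho>_def)
  have "ennreal (\<rho> - - \<rho>) \<le> hausdorff1_outer (equidistant_circle a R s z)"
  proof (rule hausdorff1_outer_ge_projection)
    show "dist ((x - a) \<bullet> e1) ((y - a) \<bullet> e1) \<le> dist x y" for x y
      using Cauchy_Schwarz_ineq2[of "x - y" e1] e by (simp add: dist_norm inner_diff_left)
    show "{- \<rho>..\<rho>} \<subseteq> (\<lambda>x. (x - a) \<bullet> e1) ` equidistant_circle a R s z"
    proof
      fix u assume "u \<in> {- \<rho>..\<rho>}"
      then have "u\<^sup>2 \<le> \<rho>\<^sup>2" using \<rho>(1) by (simp add: abs_le_square_iff[symmetric] abs_le_iff)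
      \<comment> \<open>The coordinate along \<open>e2\<close> is obtained by solving the circle
        equation; the radicand is nonnegative because \<open>u\<^sup>2 \<le> R\<^sup>2 - b\<^sup>2
        \<le> R\<^sup>2 - q\<^sup>2\<close>.\<close>
      then have "u\<^sup>2 + (sqrt (R\<^sup>2 - q\<^sup>2 - u\<^sup>2))\<^sup>2 = R\<^sup>2 - q\<^sup>2" using qb \<rho> by simp
      then have "a + q *\<^sub>R n + u *\<^sub>R e1 + sqrt (R\<^sup>2 - q\<^sup>2 - u\<^sup>2) *\<^sub>R e2 \<in> equidistant_circle a R s z"
        using C b unfolding q_def by blast
      moreover have "e1 \<bullet> e1 = 1" using e by (simp add: norm_eq_1)
      then have "u = (a + q *\<^sub>R n + u *\<^sub>R e1 + sqrt (R\<^sup>2 - q\<^sup>2 - u\<^sup>2) *\<^sub>R e2 - a) \<bullet> e1"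
        using e by (simp add: inner_add_left inner_add_right inner_commute)
      ultimately show "u \<in> (\<lambda>x. (x - a) \<bullet> e1) ` equidistant_circle a R s z" by blast
    qed
  qed (use \<rho> in simp)
  then show ?thesis by (simp add: \<rho>_def)
qed

section \<open>The pairing of two spherical waves\<close>

lemma GDERIV_unique:
  assumes "GDERIV f x :> g" "GDERIV f x :> g'"
  shows "g = g'"
proof -
  have "(\<lambda>h. h \<bullet> g) = (\<lambda>h. h \<bullet> g')"
    using assms unfolding gderiv_def by (rule has_derivative_unique)
  then show ?thesis by (metis inner_commute vector_eq_ldot)
qed

lemma gradient_eqI: "GDERIV h x :> g \<Longrightarrow> gradient h x = g"
  unfolding gradient_def using GDERIV_unique by blast

lemma GDERIV_norm_diff:
  assumes "x \<noteq> y"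
  shows "GDERIV (\<lambda>x. norm (x - y)) x :> sgn (x - y)"
proof -
  have "((\<lambda>x. x - y) has_derivative (\<lambda>h. h)) (at x)" by (auto intro!: derivative_eq_intros)
  from has_derivative_compose[OF this, of norm "\<lambda>h. h \<bullet> sgn (x - y)"]
  have "((\<lambda>x. norm (x - y)) has_derivative (\<lambda>h. h \<bullet> sgn (x - y))) (at x)"
    using GDERIV_norm[of "x - y"] assms by (simp add: gderiv_def)
  then show ?thesis by (simp add: gderiv_def)
qed

text \<open>Away from s and z, the Euclidean gradient of the difference of the arrival times from s
  and from z.\<close>

definition delay_gradient :: "real \<Rightarrow> 'a::real_inner \<Rightarrow> 'a \<Rightarrow> 'a \<Rightarrow> 'a" where
  "delay_gradient c s z x = (sgn (x - s) - sgn (x - z)) /\<^sub>R c"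

lemma GDERIV_delay:
  assumes "x \<noteq> s" "x \<noteq> z"
  shows "GDERIV (\<lambda>x. norm (x - s) / c - norm (x - z) / c) x :> delay_gradient c s z x"
proof -
  have "GDERIV (\<lambda>x. norm (x - s) - norm (x - z)) x :> sgn (x - s) - sgn (x - z)"
    by (intro GDERIV_diff GDERIV_norm_diff assms)
  then have "((\<lambda>x. (norm (x - s) - norm (x - z)) * inverse c) has_derivative
      (\<lambda>h. (h \<bullet> (sgn (x - s) - sgn (x - z))) * inverse c)) (at x)"
    unfolding gderiv_def by (rule has_derivative_mult_left)
  then show ?thesis
    unfolding gderiv_def delay_gradient_def
    by (simp add: divide_inverse right_diff_distrib mult.commute)
qed

lemma continuous_on_delay_gradient:
  "continuous_on (- {s, z}) (delay_gradient c s z)"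
  unfolding delay_gradient_def sgn_div_norm by (intro continuous_intros) auto

text \<open>The two unit vectors have a common denominator, so x drops out of the numerator. The
  remaining factor \<open>z - s\<close> is the source of the blow-up.\<close>

lemma delay_gradient_equidistant:
  assumes "norm (x - s) = norm (x - z)"
  shows "delay_gradient c s z x = (z - s) /\<^sub>R (c * norm (x - s))"
  using assms by (simp add: delay_gradient_def sgn_div_norm scaleR_diff_right[symmetric])

text \<open>Pythagoras: the squared norm drops by the square of the removed component.\<close>

lemma norm_tangential_part_le:
  fixes g \<nu> :: "'a::real_inner"
  assumes "norm \<nu> = 1"
  shows "norm (g - (g \<bullet> \<nu>) *\<^sub>R \<nu>) \<le> norm g"
proof -
  have "(norm (g - (g \<bullet> \<nu>) *\<^sub>R \<nu>))\<^sup>2 = (norm g)\<^sup>2 - (g \<bullet> \<nu>)\<^sup>2"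
    using assms unfolding power2_norm_eq_inner norm_eq_1
    by (simp add: inner_diff_left inner_diff_right inner_commute power2_eq_square)
  then have "(norm (g - (g \<bullet> \<nu>) *\<^sub>R \<nu>))\<^sup>2 \<le> (norm g)\<^sup>2" by simp
  then show ?thesis by (rule power2_le_imp_le) simp
qed

text \<open>If \<open>z - s\<close> were normal to the sphere at an equidistant point \<open>x\<close>, then \<open>x - a\<close> would be
  orthogonal to \<open>x - midpoint s z\<close>, which is impossible because the midpoint lies in the ball.\<close>

lemma equidistant_transversal:
  fixes a s z x :: "'a::euclidean_space"
  assumes "s \<in> ball a R" "z \<in> ball a R" "s \<noteq> z" "x \<in> sphere a R" "norm (x - s) = norm (x - z)"
  shows "z - s \<noteq> l *\<^sub>R (x - a)"
proof
  assume l: "z - s = l *\<^sub>R (x - a)"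
  define m where "m = midpoint s z"
  have "midpoint s z \<in> closed_segment s z" by (rule midpoint_in_closed_segment)
  then have "m \<in> ball a R"
    using closed_segment_subset[OF assms(1,2) convex_ball] unfolding m_def by blast
  then have m: "norm (m - a) < R" by (simp add: dist_norm norm_minus_commute)
  have x: "norm (x - a) = R" using assms by (simp add: dist_norm norm_minus_commute)
  have "l \<noteq> 0" using l assms(3) by auto
  moreover have "l * ((x - m) \<bullet> (x - a)) = 0"
    using assms(5) l unfolding equidistant_iff m_def by simp
  ultimately have "(x - m) \<bullet> (x - a) = 0" by simp
  then have "(x - a) \<bullet> (x - a) = (m - a) \<bullet> (x - a)" by (simp add: algebra_simps)
  then have "R\<^sup>2 = (m - a) \<bullet> (x - a)" using x by (simp add: power2_norm_eq_inner[symmetric])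
  also have "\<dots> \<le> norm (m - a) * R"
    using norm_cauchy_schwarz[of "m - a" "x - a"] x by simp
  also have "\<dots> < R * R"
    using m norm_ge_zero[of "m - a"] by (intro mult_strict_right_mono) linarith+
  finally show False by (simp add: power2_eq_square)
qed

section \<open>The contribution of a single source\<close>

abbreviation source_pairing :: "real^3 \<Rightarrow> real \<Rightarrow> real \<Rightarrow> real \<Rightarrow> real^3 \<Rightarrow> real^3 \<Rightarrow> ennreal" where
  "source_pairing a R c t s z \<equiv>
     pulse_product_integral a R (scale_pulse t (time_conv (green c s) dirac_signal))
       (time_conv (green c z) dirac_signal)"

text \<open>Scaling changes the amplitude only. Both pulses have the same arrival times, so the
  convention for the squared delta applies.\<close>

lemma source_pairing_self: "source_pairing a R c t s s = \<infinity>"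
  by (simp add: pulse_product_integral_def scale_pulse_def)

text \<open>The integrand of \<open>surface_delta_integral\<close> for two Green's functions, with
  the definite description in \<open>gradient\<close> replaced by the closed form that holds on the
  sphere.\<close>

definition pairing_density :: "real^3 \<Rightarrow> real \<Rightarrow> real \<Rightarrow> real^3 \<Rightarrow> real^3 \<Rightarrow> real^3 \<Rightarrow> real" where
  "pairing_density a c t s z x =
     t / (16 * pi\<^sup>2 * norm (x - s) * norm (x - z)) /
       norm (delay_gradient c s z x
         - (delay_gradient c s z x \<bullet> sgn (x - a)) *\<^sub>R sgn (x - a))"

context
  fixes a s z :: "real^3" and R c t :: real
  assumes c: "0 < c" and s: "s \<in> ball a R" and z: "z \<in> ball a R" and sz: "s \<noteq> z"
begin

text \<open>Keeps the amplitudes, the delay and the unit normal away from their singularities. The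
  center is excluded because a nonempty ball has positive radius.\<close>

lemma sphere_ne: "x \<in> sphere a R \<Longrightarrow> x \<noteq> s \<and> x \<noteq> z \<and> x \<noteq> a"
  using s z by (auto simp: dist_norm)

lemma tangential_delay_gradient:
  assumes "x \<in> sphere a R"
  shows "tangential_gradient a (\<lambda>x. norm (x - s) / c - norm (x - z) / c) x =
    delay_gradient c s z x - (delay_gradient c s z x \<bullet> sgn (x - a)) *\<^sub>R sgn (x - a)"
  using gradient_eqI[OF GDERIV_delay, of x s z c] sphere_ne[OF assms]
  by (simp add: tangential_gradient_def Let_def)

text \<open>On the circle the gradient is a positive multiple of \<open>z - s\<close>. If its
  tangential part vanished, \<open>z - s\<close> would be normal to the sphere, contrary to
  \<open>equidistant_transversal\<close>.\<close>

lemma tangential_delay_gradient_nonzero: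
  assumes "x \<in> equidistant_circle a R s z"
  shows "delay_gradient c s z x - (delay_gradient c s z x \<bullet> sgn (x - a)) *\<^sub>R sgn (x - a) \<noteq> 0"
proof
  have x: "x \<in> sphere a R" "norm (x - s) = norm (x - z)"
    using assms by (auto simp: equidistant_circle_def)
  define k where "k = c * norm (x - s)"
  have k: "k \<noteq> 0" using c sphere_ne[OF x(1)] by (simp add: k_def)
  define p where "p = delay_gradient c s z x \<bullet> sgn (x - a)"
  assume "delay_gradient c s z x - (delay_gradient c s z x \<bullet> sgn (x - a)) *\<^sub>R sgn (x - a) = 0"
  then have "delay_gradient c s z x = p *\<^sub>R sgn (x - a)"
    unfolding p_def by (rule eq_iff_diff_eq_0[THEN iffD2])
  then have "(z - s) /\<^sub>R k = p *\<^sub>R sgn (x - a)"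
    unfolding delay_gradient_equidistant[OF x(2)] k_def .
  then have "(z - s) /\<^sub>R k = (p / norm (x - a)) *\<^sub>R (x - a)"
    by (simp add: sgn_div_norm divide_inverse)
  then have "k *\<^sub>R ((z - s) /\<^sub>R k) = k *\<^sub>R ((p / norm (x - a)) *\<^sub>R (x - a))" by simp
  then have "z - s = (k * (p / norm (x - a))) *\<^sub>R (x - a)" using k by simp
  then show False using equidistant_transversal[OF s z sz x] by blast
qed

text \<open>The arrival times differ at s, which rules out the squared delta, and the regularity
  conditions hold, which rules out the unspecified value. What remains is a genuine integral over
  the circle.\<close>

lemma source_pairing_eq:
  "source_pairing a R c t s z =
     (\<integral>\<^sup>+x\<in>equidistant_circle a R s z. ennreal (pairing_density a c t s z x) \<partial>hausdorff1)"
proof -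
  let ?h = "\<lambda>x. norm (x - s) / c - norm (x - z) / c"
  let ?f = "\<lambda>x. t * (1 / (4 * pi * norm (x - s))) * (1 / (4 * pi * norm (x - z)))"
  have arr: "(\<lambda>x. norm (x - s) / c) \<noteq> (\<lambda>x. norm (x - z) / c)"
  proof
    assume "(\<lambda>x. norm (x - s) / c) = (\<lambda>x. norm (x - z) / c)"
    from fun_cong[OF this, of s] show False using c sz by simp
  qed
  have zero: "{x \<in> sphere a R. ?h x = 0} = equidistant_circle a R s z"
    using c by (auto simp: equidistant_circle_def)
  have cont: "continuous_on (sphere a R) ?f"
    using sphere_ne by (intro continuous_intros) auto
  have C1: "C1_near (sphere a R) ?h"
    unfolding C1_near_def
  proof (intro exI conjI ballI)
    show "open (- {s, z})" by (intro open_Compl) auto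
    show "sphere a R \<subseteq> - {s, z}" using sphere_ne by blast
    show "continuous_on (- {s, z}) (delay_gradient c s z)" by (rule continuous_on_delay_gradient)
    show "GDERIV ?h x :> delay_gradient c s z x" if "x \<in> - {s, z}" for x
      using that by (intro GDERIV_delay) auto
  qed
  have reg: "\<forall>x\<in>sphere a R. ?h x = 0 \<longrightarrow> tangential_gradient a ?h x \<noteq> 0"
  proof (intro ballI impI)
    fix x assume x: "x \<in> sphere a R" "?h x = 0"
    then have "x \<in> equidistant_circle a R s z" using zero by blast
    then show "tangential_gradient a ?h x \<noteq> 0"
      unfolding tangential_delay_gradient[OF x(1)] by (rule tangential_delay_gradient_nonzero)
  qed
  have "source_pairing a R c t s z = surface_delta_integral a R ?f ?h"
    using arr by (simp add: pulse_product_integral_def scale_pulse_def time_conv_def green_def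
        dirac_signal_def)
  also have "\<dots> = (\<integral>\<^sup>+x\<in>equidistant_circle a R s z.
      ennreal (?f x / norm (tangential_gradient a ?h x)) \<partial>hausdorff1)"
    unfolding surface_delta_integral_def zero using cont C1 reg by simp
  also have "\<dots> = (\<integral>\<^sup>+x\<in>equidistant_circle a R s z.
      ennreal (pairing_density a c t s z x) \<partial>hausdorff1)"
  proof (intro nn_integral_cong)
    fix x
    show "ennreal (?f x / norm (tangential_gradient a ?h x)) * indicator (equidistant_circle a R s z) x
      = ennreal (pairing_density a c t s z x) * indicator (equidistant_circle a R s z) x"
    proof (cases "x \<in> equidistant_circle a R s z")
      case True
      then have "x \<in> sphere a R" by (simp add: equidistant_circle_def)
      then show ?thesis
        unfolding tangential_delay_gradient[OF \<open>x \<in> sphere a R\<close>] pairing_density_def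
        by (simp add: power2_eq_square mult_ac)
    qed simp
  qed
  finally show ?thesis .
qed

lemma source_pairing_finite: "source_pairing a R c t s z < \<infinity>"
proof -
  let ?C = "equidistant_circle a R s z"
  have C: "?C \<subseteq> sphere a R" by (auto simp: equidistant_circle_def)
  have grad: "continuous_on ?C (delay_gradient c s z)"
  proof (rule continuous_on_subset[OF continuous_on_delay_gradient])
    show "?C \<subseteq> - {s, z}" using C sphere_ne by blast
  qed
  have xa: "\<forall>x\<in>?C. norm (x - a) \<noteq> 0" using C sphere_ne by auto
  have "continuous_on ?C (pairing_density a c t s z)"
    unfolding pairing_density_def[abs_def] sgn_div_norm
  proof (intro xa grad continuous_intros ballI)
    fix x assume x: "x \<in> ?C"
    show "16 * pi\<^sup>2 * norm (x - s) * norm (x - z) \<noteq> 0" using x C sphere_ne[of x] by auto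
    show "norm (delay_gradient c s z x - (delay_gradient c s z x \<bullet> ((x - a) /\<^sub>R norm (x - a))) *\<^sub>R
        ((x - a) /\<^sub>R norm (x - a))) \<noteq> 0"
      using tangential_delay_gradient_nonzero[OF x] by (simp add: sgn_div_norm)
  qed
  then have "bounded (pairing_density a c t s z ` ?C)"
    by (intro compact_imp_bounded compact_continuous_image compact_equidistant_circle)
  then obtain M where M: "\<And>x. x \<in> ?C \<Longrightarrow> pairing_density a c t s z x \<le> M"
    unfolding bounded_iff by (metis abs_le_D1 image_eqI real_norm_def)
  \<comment> \<open>The density is compared pointwise with the constant M, so the integral reduces
    to the measure of the circle, a Borel set.\<close>
  have borel: "?C \<in> sets borel" by (simp add: compact_equidistant_circle borel_compact)
  have "source_pairing a R c t s z \<le> (\<integral>\<^sup>+x\<in>?C. ennreal M \<partial>hausdorff1)"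
    unfolding source_pairing_eq
    by (intro nn_integral_mono) (auto simp: indicator_def intro!: ennreal_leI M)
  also have "\<dots> = ennreal M * hausdorff1_outer ?C"
    using borel by (simp add: nn_integral_cmult_indicator emeasure_hausdorff1)
  also have "\<dots> < \<infinity>"
    using hausdorff1_equidistant_circle_finite[OF sz] by (simp add: ennreal_mult_less_top)
  finally show ?thesis .
qed

lemma source_pairing_ge:
  assumes t: "0 < t" and mid: "norm (midpoint s z - a) \<le> b" and b: "b < R"
  shows "ennreal (t * c * sqrt (R\<^sup>2 - b\<^sup>2) / (16 * pi\<^sup>2 * R * norm (z - s))) \<le> source_pairing a R c t s z"
proof -
  let ?C = "equidistant_circle a R s z"
  \<comment> \<open>With \<open>r = norm (x - s)\<close>, the bound
    \<open>norm (z - s) / (c * r)\<close> on the tangential gradient cancels one of the two factors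
    r in the amplitudes; \<open>r \<le> 2 * R\<close> for the other turns 16 into 32. The factor 2
    in the length of the circle restores 16 in the end.\<close>
  let ?m = "t * c / (32 * pi\<^sup>2 * R * norm (z - s))"
  have R: "0 < R" using s by (metis ball_eq_empty empty_iff not_le)
  have dens: "?m \<le> pairing_density a c t s z x" if x: "x \<in> ?C" for x
  proof -
    have xs: "x \<in> sphere a R" "norm (x - s) = norm (x - z)"
      using x by (auto simp: equidistant_circle_def)
    define r where "r = norm (x - s)"
    have r: "0 < r" using sphere_ne[OF xs(1)] by (simp add: r_def)
    have "norm (x - s) \<le> dist x a + dist s a"
      using dist_triangle2[of x s a] by (simp add: dist_norm)
    then have r2: "r \<le> 2 * R" using xs s by (simp add: r_def dist_commute)
    define T where "T = norm (delay_gradient c s z x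
      - (delay_gradient c s z x \<bullet> sgn (x - a)) *\<^sub>R sgn (x - a))"
    have "T > 0" using tangential_delay_gradient_nonzero[OF x] by (simp add: T_def)
    have "T \<le> norm (delay_gradient c s z x)"
      unfolding T_def by (rule norm_tangential_part_le) (use sphere_ne[OF xs(1)] in \<open>simp add: norm_sgn\<close>)
    also have "\<dots> = norm (z - s) / (c * r)"
      unfolding delay_gradient_equidistant[OF xs(2)] using c
      by (simp add: r_def divide_inverse abs_mult mult_ac)
    finally have T: "T \<le> norm (z - s) / (c * r)" .
    have "(16 * pi\<^sup>2 * r * r) * T \<le> (16 * pi\<^sup>2 * r * r) * (norm (z - s) / (c * r))"
      using T r by (intro mult_left_mono) auto
    also have "\<dots> = r * (16 * pi\<^sup>2 * norm (z - s) / c)" using r c by (simp add: field_simps)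
    also have "\<dots> \<le> (2 * R) * (16 * pi\<^sup>2 * norm (z - s) / c)"
      using r2 c by (intro mult_right_mono) auto
    finally have "t / ((2 * R) * (16 * pi\<^sup>2 * norm (z - s) / c)) \<le> t / ((16 * pi\<^sup>2 * r * r) * T)"
      using t r \<open>T > 0\<close> by (intro divide_left_mono mult_pos_pos) (auto simp: R c sz sz[symmetric])
    then show ?thesis
      unfolding pairing_density_def T_def[symmetric] xs(2)[symmetric] r_def[symmetric]
      by (simp add: mult_ac)
  qed
  have borel: "?C \<in> sets borel" by (simp add: compact_equidistant_circle borel_compact)
  have "ennreal (t * c * sqrt (R\<^sup>2 - b\<^sup>2) / (16 * pi\<^sup>2 * R * norm (z - s)))
      = ennreal (?m * (2 * sqrt (R\<^sup>2 - b\<^sup>2)))" by (simp add: mult_ac)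
  also have "\<dots> = ennreal ?m * ennreal (2 * sqrt (R\<^sup>2 - b\<^sup>2))"
    using t c R by (intro ennreal_mult') simp
  also have "\<dots> \<le> ennreal ?m * hausdorff1_outer ?C"
    using hausdorff1_equidistant_circle_ge[OF sz mid] b by (intro mult_left_mono) auto
  also have "\<dots> = (\<integral>\<^sup>+x\<in>?C. ennreal ?m \<partial>hausdorff1)"
    using borel by (simp add: nn_integral_cmult_indicator emeasure_hausdorff1)
  also have "\<dots> \<le> source_pairing a R c t s z"
    unfolding source_pairing_eq
    by (intro nn_integral_mono) (auto simp: indicator_def intro!: ennreal_leI dens)
  finally show ?thesis .
qed

end

section \<open>Blow-up at the sources and the indicator function\<close>

lemma source_pairing_tendsto:
  fixes a s :: "real^3"
  assumes c: "0 < c" and t: "0 < t" and s: "s \<in> ball a R"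
  shows "(source_pairing a R c t s \<longlongrightarrow> \<infinity>) (at s)"
proof -
  \<comment> \<open>Halfway between \<open>dist s a\<close> and R: for z near s the midpoint of s
    and z stays within b of the center, and \<open>R\<^sup>2 - b\<^sup>2\<close> remains
    positive.\<close>
  define b where "b = (R + dist s a) / 2"
  have sR: "dist s a < R" using s by (simp add: dist_commute)
  have R: "0 < R" using sR zero_le_dist order.strict_trans1 by blast
  have b: "b < R" "dist s a < b" "0 \<le> b" using sR R by (auto simp: b_def)
  define k where "k = t * c * sqrt (R\<^sup>2 - b\<^sup>2) / (16 * pi\<^sup>2 * R)"
  have "b\<^sup>2 < R\<^sup>2" using b R by (intro power_strict_mono) auto
  then have k: "0 < k" using t c R by (simp add: k_def)
  have ev: "eventually (\<lambda>z. z \<in> ball a R \<and> z \<noteq> s \<and> norm (midpoint s z - a) \<le> b) (at s)"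
  proof (intro eventually_conj)
    show "\<forall>\<^sub>F z in at s. z \<in> ball a R"
      using s by (intro eventually_at_in_open') auto
    show "\<forall>\<^sub>F z in at s. z \<noteq> s" by (rule eventually_neq_at_within)
    have "((\<lambda>z. norm (midpoint s z - a)) \<longlongrightarrow> norm (midpoint s s - a)) (at s)"
      unfolding midpoint_def by (intro tendsto_intros)
    then have "\<forall>\<^sub>F z in at s. norm (midpoint s z - a) < b"
      by (rule order_tendstoD) (use b in \<open>simp add: dist_norm\<close>)
    then show "\<forall>\<^sub>F z in at s. norm (midpoint s z - a) \<le> b" by eventually_elim simp
  qed
  \<comment> \<open>The lower bound from \<open>source_pairing_ge\<close> is
    \<open>k / norm (z - s)\<close> with k independent of z, so it suffices that this quotient
    diverges.\<close>
  have "filterlim (\<lambda>z. norm (z - s)) (at_right 0) (at s)"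
    unfolding filterlim_at
    by (auto intro!: tendsto_eq_intros eventually_mono[OF eventually_neq_at_within[of s s UNIV]])
  then have "filterlim (\<lambda>z. k / norm (z - s)) at_top (at s)"
    unfolding divide_inverse
    by (intro filterlim_tendsto_pos_mult_at_top[OF tendsto_const k]
        filterlim_compose[OF filterlim_inverse_at_top_right])
  then have "((\<lambda>z. ennreal (k / norm (z - s))) \<longlongrightarrow> \<infinity>) (at s)"
    by (simp add: ennreal_tendsto_top_eq_at_top)
  then show ?thesis
    unfolding tendsto_top_iff_ennreal infinity_ennreal_def
  proof (intro allI impI)
    fix l :: real
    assume "\<forall>l\<ge>0. \<forall>\<^sub>F x in at s. ennreal l < ennreal (k / norm (x - s))" "0 \<le> l"
    then have "\<forall>\<^sub>F z in at s. ennreal l < ennreal (k / norm (z - s))" by blast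
    with ev show "\<forall>\<^sub>F z in at s. ennreal l < source_pairing a R c t s z"
    proof eventually_elim
      case (elim z)
      then show ?case
        using source_pairing_ge[OF c s, of z t b] t b
        by (auto simp: k_def mult_ac intro: order.strict_trans2)
    qed
  qed
qed

theorem theorem3p4:
  fixes c R :: real and K :: nat and s :: "nat \<Rightarrow> real^3" and \<tau> :: "nat \<Rightarrow> real"
    and a :: "real^3" and S \<Omega> D :: "(real^3) set"
    and sig :: pulse and u :: wave
    and I :: "real^3 \<Rightarrow> ennreal" and d :: "real^3 \<Rightarrow> real"
  assumes "c > 0" and "K \<ge> 1"
    and "inj_on s {1..K}" and "S = s ` {1..K}"
    and "\<And>j. j \<in> {1..K} \<Longrightarrow> \<tau> j > 0"
    and "sig = dirac_signal"
    and "causal_solution c sig K s \<tau> u" and "u = retarded_wave c sig K s \<tau>"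
    and "\<Omega> = ball a R" and "S \<subseteq> \<Omega>"
    and "D \<subseteq> \<Omega>" and "S \<subseteq> D" and "D \<inter> frontier \<Omega> = {}"
    and "\<And>z. z \<in> D \<Longrightarrow> I z = wave_product_integral a R u (time_conv (green c z) sig)"
    and "\<And>z. d z = Min ((\<lambda>j. norm (z - s j)) ` {1..K})"
  shows "(\<forall>z\<in>S. I z = \<infinity>) \<and> (\<forall>z\<in>D - S. I z < \<infinity>)
    \<and> (I \<longlongrightarrow> \<infinity>) (inf (filtercomap d (at_right 0)) (principal D))"
proof (intro conjI ballI)
  note c = assms(1) and S = assms(4) and \<tau> = assms(5) and D = assms(11)
  have sball: "s j \<in> ball a R" if "j \<in> {1..K}" for j
    using assms(4,9,10) that by blast
  have I: "I z = (\<Sum>j\<in>{1..K}. source_pairing a R c (\<tau> j) (s j) z)" if "z \<in> D" for z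
  proof -
    have "I z = (\<Sum>j\<leftarrow>[1..<Suc K]. source_pairing a R c (\<tau> j) (s j) z)"
      unfolding assms(14)[OF that] assms(6,8) wave_product_integral_def retarded_wave_def
      by (simp only: list.map_comp o_def)
    also have "\<dots> = (\<Sum>j\<in>set [1..<Suc K]. source_pairing a R c (\<tau> j) (s j) z)"
      by (rule sum_list_distinct_conv_sum_set) (rule distinct_upt)
    also have "set [1..<Suc K] = {1..K}" by auto
    finally show ?thesis .
  qed
  have I_ge: "source_pairing a R c (\<tau> j) (s j) z \<le> I z" if "z \<in> D" "j \<in> {1..K}" for z j
    unfolding I[OF that(1)] using that(2) by (intro member_le_sum) auto
  show "I z = \<infinity>" if z: "z \<in> S" for z
  proof -
    obtain j where j: "j \<in> {1..K}" "z = s j" using z S by blast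
    have "z \<in> D" using z assms(12) by blast
    from I_ge[OF this j(1)] show ?thesis
      unfolding j(2) source_pairing_self by (simp add: top_unique)
  qed
  show "I z < \<infinity>" if z: "z \<in> D - S" for z
  proof -
    have "source_pairing a R c (\<tau> j) (s j) z < \<infinity>" if j: "j \<in> {1..K}" for j
      using z j S D assms(9) by (intro source_pairing_finite[OF c sball[OF j]]) auto
    then show ?thesis using I z by (simp add: less_top)
  qed
  \<comment> \<open>Points of D with \<open>d z\<close> tending to 0 through positive values, that
    is, approach to S from outside S.\<close>
  show "(I \<longlongrightarrow> \<infinity>) (inf (filtercomap d (at_right 0)) (principal D))"
    unfolding infinity_ennreal_def tendsto_top_iff_ennreal
  proof (intro allI impI)
    fix l :: real assume l: "0 \<le> l"
    have "\<exists>\<delta>>0. \<forall>z. z \<noteq> s j \<and> dist z (s j) < \<delta> \<longrightarrow>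
        ennreal l < source_pairing a R c (\<tau> j) (s j) z" if j: "j \<in> {1..K}" for j
      using source_pairing_tendsto[OF c \<tau>[OF j] sball[OF j]] l
      unfolding infinity_ennreal_def tendsto_top_iff_ennreal eventually_at by simp
    then obtain \<delta> where \<delta>: "\<And>j. j \<in> {1..K} \<Longrightarrow> 0 < \<delta> j"
      "\<And>j z. \<lbrakk>j \<in> {1..K}; z \<noteq> s j; dist z (s j) < \<delta> j\<rbrakk> \<Longrightarrow>
        ennreal l < source_pairing a R c (\<tau> j) (s j) z"
      by metis
    \<comment> \<open>The nearest source depends on z, so one radius has to serve all of the
      finitely many sources.\<close>
    define \<delta>0 where "\<delta>0 = Min (\<delta> ` {1..K})"
    have ne: "{1..K} \<noteq> {}" using assms(2) by simp
    have \<delta>0: "0 < \<delta>0" "\<And>j. j \<in> {1..K} \<Longrightarrow> \<delta>0 \<le> \<delta> j"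
      using ne \<delta>(1) by (auto simp: \<delta>0_def)
    have near: "ennreal l < I z" if z: "z \<in> D" "0 < d z" "d z < \<delta>0" for z
    proof -
      \<comment> \<open>The minimum is attained at some source j. Its term alone exceeds
        \<open>l\<close>, and the other terms are nonnegative.\<close>
      have "d z \<in> (\<lambda>j. norm (z - s j)) ` {1..K}"
        unfolding assms(15) using ne by (intro Min_in) auto
      then obtain j where j: "j \<in> {1..K}" "d z = norm (z - s j)" by blast
      have "ennreal l < source_pairing a R c (\<tau> j) (s j) z"
        using z j \<delta>0(2)[OF j(1)] by (intro \<delta>(2)) (auto simp: dist_norm)
      also have "\<dots> \<le> I z" by (rule I_ge[OF z(1) j(1)])
      finally show ?thesis .
    qed
    have "eventually (\<lambda>r. 0 < r \<and> r < \<delta>0) (at_right 0)"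
      using \<delta>0(1) by (auto simp: eventually_at_right_field)
    then have "eventually (\<lambda>z. 0 < d z \<and> d z < \<delta>0) (filtercomap d (at_right 0))"
      by (rule eventually_filtercomapI)
    then show "\<forall>\<^sub>F z in inf (filtercomap d (at_right 0)) (principal D). ennreal l < I z"
      unfolding eventually_inf_principal by eventually_elim (use near in auto)
  qed
qed

end
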